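(* Let $X_i=\theta_i+\varepsilon_i\in\mathbb{R}^d$, $i=1,\dots,n$, where $\theta_1,\dots,\theta_n\in\mathbb{R}^d$ are fixed and $\varepsilon_1,\dots,\varepsilon_n$ are i.i.d. $\mathcal{N}(0,\Sigma)$ with $\Sigma$ a nonnegative definite $d\times d$ matrix. Let $g\in\mathbb{N}$, $\mu_n=\frac1n\sum_{i=1}^n\delta_{X_i}$ and $\nu_n=\frac1n\sum_{i=1}^n\delta_{\theta_i}$. Then $$\mathbb{E}\left[\mathbb{M}_g(\mu_n)\right]=\frac1n\sum_{i=1}^n\sum_{k=0}^{g}C_{2g,k}\,h_{\kappa_{d,g}}(\gamma_g\otimes\gamma_g)\left(\operatorname{sym}\left(\tilde\theta_i^{\otimes(2g-2k)}\otimes\tilde\Sigma^{\otimes k}\right)\right),$$ where $C_{g,k}:=\binom{g}{2k}\frac{(2k)!}{k!\,2^k}$. Moreover, $$\hat{\mathbb{M}}_g:=\frac1n\sum_{i=1}^nM_{n,i},\qquad M_{n,i}:=\sum_{k=0}^{g}C_{2g,k}(-1)^k\,h_{\kappa_{d,g}}(\gamma_g\otimes\gamma_g)\left(\operatorname{sym}\left(\tilde X_i^{\otimes(2g-2k)}\otimes\tilde\Sigma^{\otimes k}\right)\right),$$ is an unbiased estimator of $\mathbb{M}_g(\nu_n)$, i.e. $\mathbb{E}[\hat{\mathbb{M}}_g]=\mathbb{M}_g(\nu_n)$.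
   Context: $\mathbb{N}=\{1,2,\dots\}$, $\mathbb{N}_0=\{0,1,\dots\}$. For $x=(x_1,\dots,x_d)\in\mathbb{R}^d$ write $\tilde x=(1,x_1,\dots,x_d)\in\mathbb{R}^{d+1}$, and for $\mathbf{i}=(i_0,\dots,i_d)\in\mathbb{N}_0^{d+1}$ write $\tilde x^{\mathbf{i}}=x_1^{i_1}\cdots x_d^{i_d}$ (with $0^0=1$). Let $\mathcal{B}_{d,g}=\{\mathbf{i}\in\mathbb{N}_0^{d+1}:\sum_{j=0}^d i_j=g\}$, equipped with a fixed total order, and $\kappa_{d,g}=|\mathcal{B}_{d,g}|=\binom{d+g}{d}$. The Veronese map is $\phi(x)=(\tilde x^{\mathbf{i}})_{\mathbf{i}\in\mathcal{B}_{d,g}}\in\mathbb{R}^{\kappa_{d,g}}$ (a column vector). For a Borel probability measure $\mu$ on $\mathbb{R}^d$ with finite $2g$-th moment, $\mathbb{M}_g(\mu)=\mathbb{E}_{Y\sim\mu}[\phi(Y)\phi(Y)^\top]$ (moment matrix of order $g$); for $\mu_n$ this is $\frac1n\sum_i\phi(X_i)\phi(X_i)^\top$. For $m\in\mathbb{N}$, $\operatorname{sym}:(\mathbb{R}^{d+1})^{\otimes m}\to(\mathbb{R}^{d+1})^{\otimes m}$ is the linear map with $\operatorname{sym}(v_1\otimes\cdots\otimes v_m)=\frac1{m!}\sum_{\tau}v_{\tau(1)}\otimes\cdots\otimes v_{\tau(m)}$, the sum being over all permutations $\tau$ of $\{1,\dots,m\}$. $\gamma_g:\operatorname{sym}((\mathbb{R}^{d+1})^{\otimes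 g})\to\mathbb{R}^{\kappa_{d,g}}$ is the linear bijection such that $\gamma_g(\tilde x^{\otimes g})=\phi(x)$ for all $x\in\mathbb{R}^d$. $h_{k}:\mathbb{R}^k\otimes\mathbb{R}^k\to\mathcal{M}_{k\times k}(\mathbb{R})$ is the linear isomorphism with $h_k(u\otimes v)=uv^\top$. $\tilde\Sigma=\begin{pmatrix}0&0\\0&\Sigma\end{pmatrix}\in\mathcal{M}_{(d+1)\times(d+1)}(\mathbb{R})$, viewed as an element of $\mathbb{R}^{d+1}\otimes\mathbb{R}^{d+1}$ through $h_{d+1}^{-1}$. Symmetric tensors of order $2g$ are regarded as elements of $\operatorname{sym}((\mathbb{R}^{d+1})^{\otimes g})\otimes\operatorname{sym}((\mathbb{R}^{d+1})^{\otimes g})$. *)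

theory Defs
  imports "HOL-Probability.Probability" "HOL-Combinatorics.Permutations"
begin

text \<open>
  Tensors of order \<open>m\<close> over the space \<open>real ^ 'i\<close> are given by their coordinates, which are
  indexed by the lists of length \<open>m\<close> over \<open>'i\<close>. An element of the type below consists of one
  tensor of each order; the space \<open>(real ^ 'i)\<^sup>\<otimes>\<^sup>m\<close> is its subspace \<open>tensors m\<close>. In the
  ring structure, multiplication is the tensor product and \<open>T ^ k\<close> is the \<open>k\<close>-th tensor power
  (\<open>T ^ 0\<close> being the unit scalar, a tensor of order 0).
\<close>

typedef 'i tensor = "UNIV :: ('i list \<Rightarrow> real) set"
  morphisms tcoeff Tensor
  by simp

setup_lifting type_definition_tensor

lemma tensor_eqI: "(\<And>js. tcoeff S js = tcoeff T js) \<Longrightarrow> S = T"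
  by transfer auto

instantiation tensor :: (type) real_vector
begin

lift_definition zero_tensor :: "'a tensor" is "\<lambda>_. 0" .
lift_definition plus_tensor :: "'a tensor \<Rightarrow> 'a tensor \<Rightarrow> 'a tensor" is "\<lambda>S T js. S js + T js" .
lift_definition uminus_tensor :: "'a tensor \<Rightarrow> 'a tensor" is "\<lambda>T js. - T js" .
lift_definition minus_tensor :: "'a tensor \<Rightarrow> 'a tensor \<Rightarrow> 'a tensor" is "\<lambda>S T js. S js - T js" .
lift_definition scaleR_tensor :: "real \<Rightarrow> 'a tensor \<Rightarrow> 'a tensor" is "\<lambda>c T js. c * T js" .

instance
  by standard (transfer; simp add: fun_eq_iff algebra_simps)+

end

lemma sum_splits_assoc:
  fixes f :: "nat \<Rightarrow> nat \<Rightarrow> 'a::comm_monoid_add"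
  shows "(\<Sum>k\<le>n. \<Sum>l\<le>k. f l (k - l)) = (\<Sum>l\<le>n. \<Sum>m\<le>n - l. f l m)"
proof -
  have "(\<Sum>k\<le>n. \<Sum>l\<le>k. f l (k - l)) = (\<Sum>(l, m)\<in>{(i, j). i + j \<le> n}. f l m)"
    by (rule sum.triangle_reindex_eq [symmetric])
  also have "{(i, j). i + j \<le> n} = (SIGMA l:{..n}. {..n - l})"
    by auto
  also have "(\<Sum>(l, m)\<in>(SIGMA l:{..n}. {..n - l}). f l m) = (\<Sum>l\<le>n. \<Sum>m\<le>n - l. f l m)"
    by (rule sum.Sigma [symmetric]) auto
  finally show ?thesis .
qed

instantiation tensor :: (type) real_algebra_1
begin

lift_definition one_tensor :: "'a tensor" is "\<lambda>js. if js = [] then 1 else 0" .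

text \<open>
  If \<open>S\<close> and \<open>T\<close> have orders \<open>p\<close> and \<open>q\<close>, then only the summand \<open>k = p\<close> survives, and
  \<open>(S \<otimes> T)(js @ ls) = S js * T ls\<close> for \<open>length js = p\<close> and \<open>length ls = q\<close>.
\<close>

lift_definition times_tensor :: "'a tensor \<Rightarrow> 'a tensor \<Rightarrow> 'a tensor" is
  "\<lambda>S T js. \<Sum>k\<le>length js. S (take k js) * T (drop k js)" .

instance
proof
  fix a b c :: "'a tensor" and r :: real
  show "a * b * c = a * (b * c)"
  proof (transfer, rule ext)
    fix a b c :: "'a list \<Rightarrow> real" and js :: "'a list"
    let ?f = "\<lambda>l m. a (take l js) * b (take m (drop l js)) * c (drop (l + m) js)"
    have "(\<Sum>k\<le>length js. (\<Sum>l\<le>length (take k js). a (take l (take k js)) * b (drop l (take k js)))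
            * c (drop k js)) = (\<Sum>k\<le>length js. \<Sum>l\<le>k. ?f l (k - l))"
      by (intro sum.cong refl)
        (auto simp: sum_distrib_right min_def drop_take intro!: sum.cong)
    also have "\<dots> = (\<Sum>l\<le>length js. \<Sum>m\<le>length js - l. ?f l m)"
      by (rule sum_splits_assoc)
    also have "\<dots> = (\<Sum>l\<le>length js. a (take l js) *
        (\<Sum>m\<le>length (drop l js). b (take m (drop l js)) * c (drop m (drop l js))))"
      by (simp add: sum_distrib_left mult.assoc add.commute)
    finally show "(\<Sum>k\<le>length js. (\<Sum>l\<le>length (take k js). a (take l (take k js)) * b (drop l (take k js)))
            * c (drop k js)) = \<dots>" .
  qed
  show "1 * a = a"
  proof (transfer, rule ext)
    fix a :: "'a list \<Rightarrow> real" and js :: "'a list"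
    have "(\<Sum>k\<le>length js. (if take k js = [] then 1 else 0) * a (drop k js))
        = (\<Sum>k\<le>length js. if k = 0 then a js else 0)"
      by (rule sum.cong) auto
    then show "(\<Sum>k\<le>length js. (if take k js = [] then 1 else 0) * a (drop k js)) = a js"
      by simp
  qed
  show "a * 1 = a"
  proof (transfer, rule ext)
    fix a :: "'a list \<Rightarrow> real" and js :: "'a list"
    have "(\<Sum>k\<le>length js. a (take k js) * (if drop k js = [] then 1 else 0))
        = (\<Sum>k\<le>length js. if k = length js then a js else 0)"
      by (rule sum.cong) auto
    then show "(\<Sum>k\<le>length js. a (take k js) * (if drop k js = [] then 1 else 0)) = a js"
      by simp
  qed
  show "(a + b) * c = a * c + b * c"
    by transfer (simp add: fun_eq_iff algebra_simps sum.distrib)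
  show "a * (b + c) = a * b + a * c"
    by transfer (simp add: fun_eq_iff algebra_simps sum.distrib)
  show "r *\<^sub>R a * b = r *\<^sub>R (a * b)"
    by transfer (simp add: fun_eq_iff algebra_simps sum_distrib_left)
  show "a * r *\<^sub>R b = r *\<^sub>R (a * b)"
    by transfer (simp add: fun_eq_iff algebra_simps sum_distrib_left)
  show "(0::'a tensor) \<noteq> 1"
    by transfer (auto simp: fun_eq_iff)
qed

end

definition tensors :: "nat \<Rightarrow> 'i tensor set" where
  "tensors m = {T. \<forall>js. length js \<noteq> m \<longrightarrow> tcoeff T js = 0}"

lift_definition vec_tensor :: "real ^ 'i \<Rightarrow> 'i tensor" is
  "\<lambda>v js. case js of [j] \<Rightarrow> v $ j | _ \<Rightarrow> 0" .

text \<open>The symmetrization acts on the tensors of each order \<open>m\<close>; see \<open>symm_prod_list\<close> below.\<close>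

lift_definition symm :: "'i tensor \<Rightarrow> 'i tensor" is
  "\<lambda>T js. (\<Sum>\<tau> | \<tau> permutes {..<length js}. T (permute_list \<tau> js)) / fact (length js)" .

definition sym_tensors :: "nat \<Rightarrow> 'i tensor set" where
  "sym_tensors m = symm ` tensors m"

definition outer :: "real ^ 'k \<Rightarrow> real ^ 'k \<Rightarrow> real ^ 'k ^ 'k" where
  "outer u v = (columnvector u :: real ^ 1 ^ 'k) ** (rowvector v :: real ^ 'k ^ 1)"

definition hmat :: "'k tensor \<Rightarrow> real ^ 'k ^ 'k" where
  "hmat T = (\<chi> a b. tcoeff T [a, b])"

text \<open>
  The tensor product of linear maps \<open>f\<close> on \<open>V\<close> and \<open>f'\<close> on \<open>W\<close>. It is determined on the span of
  the products of elements of \<open>V\<close> and \<open>W\<close>, which is \<open>V \<otimes> W\<close> if \<open>V\<close> and \<open>W\<close> are spaces of tensors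
  of fixed orders; for its existence see \<open>tensor_map_exists\<close> below.
\<close>

definition tensor_map ::
  "'i tensor set \<Rightarrow> ('i tensor \<Rightarrow> real ^ 'k) \<Rightarrow> 'i tensor set \<Rightarrow> ('i tensor \<Rightarrow> real ^ 'k)
    \<Rightarrow> 'i tensor \<Rightarrow> 'k tensor" where
  "tensor_map V f W f' = (SOME G. linear G \<and>
     (\<forall>S\<in>V. \<forall>T\<in>W. G (S * T) = vec_tensor (f S) * vec_tensor (f' T)))"

text \<open>
  The index \<open>0\<close> of the coordinates of \<open>\<real>\<^bsup>d+1\<^esup>\<close> is \<open>None\<close>, the indices \<open>1, \<dots>, d\<close> are \<open>Some i\<close>.
\<close>

definition lift1 :: "real ^ 'd \<Rightarrow> real ^ 'd option" where
  "lift1 x = (\<chi> j. case j of None \<Rightarrow> 1 | Some i \<Rightarrow> x $ i)"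

definition lift0 :: "real ^ 'd ^ 'd \<Rightarrow> real ^ 'd option ^ 'd option" where
  "lift0 A = (\<chi> j l. case (j, l) of (Some a, Some b) \<Rightarrow> A $ a $ b | _ \<Rightarrow> 0)"

definition mat_tensor :: "real ^ 'k ^ 'k \<Rightarrow> 'k tensor" where
  "mat_tensor = inv_into (tensors 2) hmat"

definition multi_indices :: "nat \<Rightarrow> ('d::finite option \<Rightarrow> nat) set" where
  "multi_indices g = {i. (\<Sum>j\<in>UNIV. i j) = g}"

definition monom_at :: "real ^ 'd \<Rightarrow> ('d::finite option \<Rightarrow> nat) \<Rightarrow> real" where
  "monom_at x i = (\<Prod>j\<in>UNIV. (x $ j) ^ i (Some j))"

text \<open>
  Vectors and matrices indexed by \<open>multi_indices g\<close> are represented by vectors and matrices over a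
  finite index type \<open>'b\<close> together with an enumeration \<open>idx :: 'b \<Rightarrow> _\<close> of the multi-indices, i.e.
  \<open>bij_betw idx UNIV (multi_indices g)\<close>.
\<close>

definition veronese :: "('b \<Rightarrow> 'd option \<Rightarrow> nat) \<Rightarrow> real ^ 'd \<Rightarrow> real ^ 'b" where
  "veronese idx x = (\<chi> b. monom_at x (idx b))"

definition moment_matrix ::
  "('b::finite \<Rightarrow> 'd::finite option \<Rightarrow> nat) \<Rightarrow> (real ^ 'd) measure \<Rightarrow> real ^ 'b ^ 'b" where
  "moment_matrix idx \<mu> = (\<integral>y. outer (veronese idx y) (veronese idx y) \<partial>\<mu>)"

text \<open>
  Only the values on \<open>sym_tensors g\<close> are meaningful; this space is spanned by the tensor powers of
  the vectors \<open>lift1 x\<close>. For the existence of \<open>\<gamma>\<close> see \<open>gamma_map_exists\<close> below.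
\<close>

definition gamma_map ::
  "('b::finite \<Rightarrow> 'd::finite option \<Rightarrow> nat) \<Rightarrow> nat \<Rightarrow> 'd option tensor \<Rightarrow> real ^ 'b" where
  "gamma_map idx g = (SOME \<gamma>. linear \<gamma> \<and> bij_betw \<gamma> (sym_tensors g) UNIV \<and>
     (\<forall>x. \<gamma> (vec_tensor (lift1 x) ^ g) = veronese idx x))"

definition gamma_gamma ::
  "('b::finite \<Rightarrow> 'd::finite option \<Rightarrow> nat) \<Rightarrow> nat \<Rightarrow> 'd option tensor \<Rightarrow> 'b tensor" where
  "gamma_gamma idx g = tensor_map (sym_tensors g) (gamma_map idx g) (sym_tensors g) (gamma_map idx g)"

text \<open>The measure \<open>1/n (\<delta>(x 1) + \<dots> + \<delta>(x n))\<close> on the Borel sets; see \<open>emeasure_empirical_measure\<close> below.\<close>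

definition empirical_measure :: "nat \<Rightarrow> (nat \<Rightarrow> 'a::topological_space) \<Rightarrow> 'a measure" where
  "empirical_measure n x = distr (uniform_count_measure {1..n}) borel x"

text \<open>
  A multivariate normal distribution is defined by its one-dimensional projections, so that the
  covariance matrix may be singular. Note that \<open>normal_density\<close> takes the standard deviation.
\<close>

definition normal_measure :: "real \<Rightarrow> real \<Rightarrow> real measure" where
  "normal_measure m v =
     (if v = 0 then return borel m else density lborel (\<lambda>x. ennreal (normal_density m (sqrt v) x)))"

definition is_normal :: "real ^ 'd \<Rightarrow> real ^ 'd ^ 'd \<Rightarrow> (real ^ 'd) measure \<Rightarrow> bool" where
  "is_normal m S N \<longleftrightarrow> sets N = sets borel \<and>
     (\<forall>u. distr N borel (\<lambda>y. u \<bullet> y) = normal_measure (u \<bullet> m) (u \<bullet> (S *v u)))"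

definition nonneg_definite :: "real ^ 'd ^ 'd \<Rightarrow> bool" where
  "nonneg_definite S \<longleftrightarrow> transpose S = S \<and> (\<forall>u. 0 \<le> u \<bullet> (S *v u))"

definition herm_coeff :: "nat \<Rightarrow> nat \<Rightarrow> real" where
  "herm_coeff g k = real (g choose (2 * k)) * fact (2 * k) / (fact k * 2 ^ k)"

definition debiased_term ::
  "('b::finite \<Rightarrow> 'd::finite option \<Rightarrow> nat) \<Rightarrow> nat \<Rightarrow> real ^ 'd ^ 'd \<Rightarrow> real ^ 'd \<Rightarrow> real ^ 'b ^ 'b" where
  "debiased_term idx g S x = (\<Sum>k=0..g. (herm_coeff (2 * g) k * (-1) ^ k) *\<^sub>R
     hmat (gamma_gamma idx g (symm (vec_tensor (lift1 x) ^ (2 * g - 2 * k) * mat_tensor (lift0 S) ^ k))))"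

definition debiased_estimator ::
  "('b::finite \<Rightarrow> 'd::finite option \<Rightarrow> nat) \<Rightarrow> nat \<Rightarrow> real ^ 'd ^ 'd \<Rightarrow> nat \<Rightarrow> (nat \<Rightarrow> real ^ 'd)
    \<Rightarrow> real ^ 'b ^ 'b" where
  "debiased_estimator idx g S n x = (1 / real n) *\<^sub>R (\<Sum>i=1..n. debiased_term idx g S (x i))"


subsection \<open>The characterizing properties of these notions\<close>

lemma tcoeff_sum: "tcoeff (\<Sum>a\<in>A. F a) js = (\<Sum>a\<in>A. tcoeff (F a) js)"
  by (induction A rule: infinite_finite_induct) (simp_all add: zero_tensor.rep_eq plus_tensor.rep_eq)

lemma linear_symm: "linear symm"
  by (rule linearI; transfer)
    (simp_all add: fun_eq_iff sum.distrib add_divide_distrib sum_distrib_left)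

lemma tcoeff_prod_list_vec:
  "tcoeff (prod_list (map vec_tensor vs)) js =
     (if length js = length vs then \<Prod>k<length vs. (vs ! k) $ (js ! k) else 0)"
proof (induction vs arbitrary: js)
  case Nil
  then show ?case by (simp add: one_tensor.rep_eq)
next
  case (Cons v vs)
  have "tcoeff (prod_list (map vec_tensor (v # vs))) js =
      (\<Sum>k\<le>length js. tcoeff (vec_tensor v) (take k js) * tcoeff (prod_list (map vec_tensor vs)) (drop k js))"
    by (simp add: times_tensor.rep_eq)
  also have "\<dots> = (\<Sum>k\<le>length js. if k = 1 then
      tcoeff (vec_tensor v) (take 1 js) * tcoeff (prod_list (map vec_tensor vs)) (drop 1 js) else 0)"
    by (intro sum.cong refl) (auto simp: vec_tensor.rep_eq split: list.split dest!: arg_cong[where f = length])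
  also have "\<dots> = (if length js = length (v # vs)
      then \<Prod>k<length (v # vs). ((v # vs) ! k) $ (js ! k) else 0)"
  proof (cases js)
    case (Cons j ls)
    then show ?thesis
      unfolding Cons.IH
      by (cases "ls = []")
        (auto simp: vec_tensor.rep_eq prod.lessThan_Suc_shift Suc_le_eq simp del: prod.lessThan_Suc)
  qed simp
  finally show ?case .
qed

lemma symm_prod_list:
  "symm (prod_list (map vec_tensor vs)) =
     (1 / fact (length vs)) *\<^sub>R
       (\<Sum>\<tau> | \<tau> permutes {..<length vs}. prod_list (map vec_tensor (permute_list \<tau> vs)))"
proof (rule tensor_eqI)
  fix js :: "'a list"
  show "tcoeff (symm (prod_list (map vec_tensor vs))) js = tcoeff ((1 / fact (length vs)) *\<^sub>R
       (\<Sum>\<tau> | \<tau> permutes {..<length vs}. prod_list (map vec_tensor (permute_list \<tau> vs)))) js"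
  proof (cases "length js = length vs")
    case True
    let ?n = "length vs"
    have 1: "(\<Prod>k<?n. (vs ! k) $ (js ! (inv \<tau> k))) = (\<Prod>k<?n. (vs ! (\<tau> k)) $ (js ! k))"
      if "\<tau> permutes {..<?n}" for \<tau>
    proof -
      have "(\<Prod>k<?n. (vs ! k) $ (js ! (inv \<tau> k))) = (\<Prod>k<?n. (vs ! (\<tau> k)) $ (js ! (inv \<tau> (\<tau> k))))"
        using prod.permute[OF that, of "\<lambda>k. (vs ! k) $ (js ! (inv \<tau> k))"] by (simp add: o_def)
      then show ?thesis
        using permutes_inverses(2)[OF that] by simp
    qed
    have "(\<Sum>\<tau> | \<tau> permutes {..<?n}. \<Prod>k<?n. (vs ! k) $ (js ! (\<tau> k)))
        = (\<Sum>\<tau> | \<tau> permutes {..<?n}. \<Prod>k<?n. (vs ! k) $ (js ! (inv \<tau> k)))"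
      by (rule sum_permutations_inverse)
    also have "\<dots> = (\<Sum>\<tau> | \<tau> permutes {..<?n}. \<Prod>k<?n. (vs ! (\<tau> k)) $ (js ! k))"
      by (intro sum.cong refl) (simp add: 1)
    finally show ?thesis
      using True
      by (simp add: symm.rep_eq scaleR_tensor.rep_eq tcoeff_sum tcoeff_prod_list_vec permute_list_nth)
  next
    case False
    then show ?thesis
      by (simp add: symm.rep_eq scaleR_tensor.rep_eq tcoeff_sum tcoeff_prod_list_vec)
  qed
qed

lemma linear_hmat: "linear hmat"
  by (rule linearI) (simp_all add: hmat_def vec_eq_iff plus_tensor.rep_eq scaleR_tensor.rep_eq)

lemma hmat_vec_tensor: "hmat (vec_tensor u * vec_tensor v) = outer u v"
  using tcoeff_prod_list_vec[of "[u, v]"]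
  by (simp add: hmat_def outer_def vec_eq_iff matrix_matrix_mult_def columnvector_def rowvector_def
      numeral_2_eq_2)

lemma bij_betw_hmat: "bij_betw hmat (tensors 2) UNIV"
proof (rule bij_betw_byWitness[where f' = "\<lambda>A. Tensor (\<lambda>js. case js of [a, b] \<Rightarrow> A $ a $ b | _ \<Rightarrow> 0)"])
  show "\<forall>T\<in>tensors 2. Tensor (\<lambda>js. case js of [a, b] \<Rightarrow> hmat T $ a $ b | _ \<Rightarrow> 0) = T"
    by (auto intro!: tensor_eqI simp: Tensor_inverse hmat_def tensors_def split: list.split)
  show "\<forall>A\<in>UNIV. hmat (Tensor (\<lambda>js. case js of [a, b] \<Rightarrow> A $ a $ b | _ \<Rightarrow> 0)) = A"
    by (simp add: hmat_def Tensor_inverse vec_eq_iff)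
  show "(\<lambda>A. Tensor (\<lambda>js. case js of [a, b] \<Rightarrow> A $ a $ b | _ \<Rightarrow> 0)) ` UNIV \<subseteq> tensors 2"
    by (auto simp: tensors_def Tensor_inverse split: list.split)
qed auto

lemma tensor_map_exists:
  fixes f f' :: "'i tensor \<Rightarrow> real ^ 'k"
  assumes f: "linear f" and f': "linear f'" and V: "V \<subseteq> tensors p" and W: "W \<subseteq> tensors q"
  shows "\<exists>G. linear G \<and> (\<forall>S\<in>V. \<forall>T\<in>W. G (S * T) = vec_tensor (f S) * vec_tensor (f' T))"
proof -
  define slice where "slice T js = Tensor (\<lambda>ls. if length ls = q then tcoeff T (js @ ls) else 0)"
    for T :: "'i tensor" and js
  define sl2 where "sl2 T s = Tensor (\<lambda>js. if length js = p then f' (slice T js) $ s else 0)" for T s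
  define G where "G T = Tensor (\<lambda>rs. case rs of [r, s] \<Rightarrow> f (sl2 T s) $ r | _ \<Rightarrow> 0)" for T
  have slice_add: "slice (S + T) js = slice S js + slice T js"
    and slice_scale: "slice (c *\<^sub>R T) js = c *\<^sub>R slice T js" for S T js c
    by (auto intro!: tensor_eqI simp: slice_def Tensor_inverse plus_tensor.rep_eq scaleR_tensor.rep_eq)
  have sl2_add: "sl2 (S + T) s = sl2 S s + sl2 T s" and sl2_scale: "sl2 (c *\<^sub>R T) s = c *\<^sub>R sl2 T s"
    for S T s c
    by (auto intro!: tensor_eqI simp: sl2_def Tensor_inverse plus_tensor.rep_eq scaleR_tensor.rep_eq
        slice_add slice_scale linear_add[OF f'] linear_scale[OF f'])
  have "linear G"
    by (rule linearI; rule tensor_eqI)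
      (auto simp: G_def Tensor_inverse plus_tensor.rep_eq scaleR_tensor.rep_eq
        sl2_add sl2_scale linear_add[OF f] linear_scale[OF f] split: list.split)
  moreover have "G (S * T) = vec_tensor (f S) * vec_tensor (f' T)" if S: "S \<in> V" and T: "T \<in> W" for S T
  proof -
    have S0: "tcoeff S js = 0" if "length js \<noteq> p" for js using S V that by (auto simp: tensors_def)
    have T0: "tcoeff T js = 0" if "length js \<noteq> q" for js using T W that by (auto simp: tensors_def)
    have prod: "tcoeff (S * T) (js @ ls) = tcoeff S js * tcoeff T ls" if "length js = p" for js ls
    proof -
      have "tcoeff (S * T) (js @ ls)
          = (\<Sum>k\<le>length (js @ ls). if k = p then tcoeff S js * tcoeff T ls else 0)"
        unfolding times_tensor.rep_eq using that
        by (intro sum.cong refl) (auto simp: S0)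
      then show ?thesis using that by simp
    qed
    have "slice (S * T) js = tcoeff S js *\<^sub>R T" if "length js = p" for js
      by (rule tensor_eqI) (use that in \<open>auto simp: slice_def Tensor_inverse scaleR_tensor.rep_eq prod T0\<close>)
    then have "sl2 (S * T) s = f' T $ s *\<^sub>R S" for s
      by (intro tensor_eqI)
        (auto simp: sl2_def Tensor_inverse scaleR_tensor.rep_eq linear_scale[OF f'] S0)
    then show ?thesis
      using tcoeff_prod_list_vec[of "[f S, f' T]"]
      by (intro tensor_eqI)
        (auto simp: G_def Tensor_inverse linear_scale[OF f] numeral_2_eq_2 split: list.split)
  qed
  ultimately show ?thesis by blast
qed

lemma sym_tensors_subset: "sym_tensors m \<subseteq> tensors m"
  by (auto simp: sym_tensors_def tensors_def symm.rep_eq)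

lemma symm_cong_mset:
  assumes "mset js = mset ls"
  shows "tcoeff (symm T) js = tcoeff (symm T) ls"
proof -
  obtain p where p: "p permutes {..<length ls}" "permute_list p ls = js"
    using mset_eq_permutation[OF assms] by blast
  have "(\<Sum>\<tau> | \<tau> permutes {..<length ls}. tcoeff T (permute_list \<tau> ls))
      = (\<Sum>\<tau> | \<tau> permutes {..<length ls}. tcoeff T (permute_list (p \<circ> \<tau>) ls))"
    by (rule sum.reindex_bij_witness[where i = "\<lambda>\<tau>. p \<circ> \<tau>" and j = "\<lambda>\<tau>. inv p \<circ> \<tau>"])
      (simp_all add: p(1) permutes_compose permutes_inv permutes_inv_o[OF p(1)] o_assoc)
  also have "\<dots> = (\<Sum>\<tau> | \<tau> permutes {..<length ls}. tcoeff T (permute_list \<tau> js))"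
    by (intro sum.cong refl) (simp add: p(2)[symmetric] permute_list_compose)
  finally show ?thesis
    using p(2) by (auto simp: symm.rep_eq)
qed

lemma prod_nth_eq_prod_count:
  fixes v :: "real ^ 'j::finite"
  shows "(\<Prod>k<length js. v $ (js ! k)) = (\<Prod>j\<in>UNIV. (v $ j) ^ count_list js j)"
proof (induction js)
  case (Cons a js)
  have "(\<Prod>j\<in>UNIV. (v $ j) ^ count_list (a # js) j)
      = (\<Prod>j\<in>UNIV. (if j = a then v $ a else 1) * (v $ j) ^ count_list js j)"
    by (rule prod.cong) auto
  also have "\<dots> = v $ a * (\<Prod>j\<in>UNIV. (v $ j) ^ count_list js j)"
    by (simp add: prod.distrib)
  finally show ?case
    by (simp add: prod.lessThan_Suc_shift Cons.IH del: prod.lessThan_Suc)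
qed simp

lemma mset_eq_iff_count_list: "mset js = mset ls \<longleftrightarrow> count_list js = count_list ls"
  by (auto simp: multiset_eq_iff count_mset)

lemma power_vec_tensor:
  fixes v :: "real ^ 'j::finite"
  shows "tcoeff (vec_tensor v ^ m) js =
    (if length js = m then \<Prod>j\<in>UNIV. (v $ j) ^ count_list js j else 0)"
proof -
  have "vec_tensor v ^ m = prod_list (map vec_tensor (replicate m v))"
    by (induction m) simp_all
  then show ?thesis
    by (auto simp: tcoeff_prod_list_vec simp del: map_replicate prod_list_replicate
        simp flip: prod_nth_eq_prod_count)
qed

lemma gamma_map_exists:
  fixes idx :: "'b::finite \<Rightarrow> 'd::finite option \<Rightarrow> nat"
  assumes idx: "bij_betw idx UNIV (multi_indices g)"
  shows "\<exists>\<gamma>. linear \<gamma> \<and> bij_betw \<gamma> (sym_tensors g) UNIV \<and>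
     (\<forall>x. \<gamma> (vec_tensor (lift1 x) ^ g) = veronese idx x)"
proof -
  have len: "(\<Sum>j\<in>UNIV. count_list js j) = length js" for js :: "'d option list"
    by (rule sum_count_set) auto
  have "\<exists>js. count_list js = idx b" for b
  proof -
    obtain js where "mset js = Abs_multiset (idx b)"
      using ex_mset by blast
    then have "count (mset js) = idx b"
      by (simp add: Abs_multiset_inverse)
    then show ?thesis
      by (auto simp: fun_eq_iff count_mset)
  qed
  then obtain r where r: "count_list (r b) = idx b" for b
    by metis
  have idx_mem: "(\<Sum>j\<in>UNIV. idx b j) = g" for b
    using bij_betw_apply[OF idx, of b] by (simp add: multi_indices_def)
  have len_r: "length (r b) = g" for b
    using len[of "r b"] by (simp add: r idx_mem)
  define inv_idx where "inv_idx = inv_into UNIV idx"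
  have inv_idx: "inv_idx (idx b) = b" for b
    using bij_betw_imp_inj_on[OF idx] by (simp add: inv_idx_def)
  have idx_inv: "idx (inv_idx (count_list js)) = count_list js" if "length js = g" for js
    unfolding inv_idx_def
    by (rule f_inv_into_f) (use idx len[of js] that in \<open>auto simp: bij_betw_def multi_indices_def\<close>)
  define \<gamma> where "\<gamma> T = (\<chi> b. tcoeff T (r b))" for T
  define \<delta> where "\<delta> v = Tensor (\<lambda>js. if length js = g then v $ inv_idx (count_list js) else 0)" for v
  have \<delta>_mem: "\<delta> v \<in> sym_tensors g" for v
  proof -
    have perm: "count_list (permute_list \<tau> js) = count_list js"
      if "\<tau> permutes {..<length js}" for \<tau> and js :: "'d option list"
      using that by (simp flip: mset_eq_iff_count_list)
    have "symm (\<delta> v) = \<delta> v"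
      by (rule tensor_eqI) (simp add: \<delta>_def symm.rep_eq Tensor_inverse perm card_permutations)
    moreover have "\<delta> v \<in> tensors g"
      by (simp add: \<delta>_def tensors_def Tensor_inverse)
    ultimately show ?thesis
      unfolding sym_tensors_def by force
  qed
  have "linear \<gamma>"
    by (rule linearI) (simp_all add: \<gamma>_def vec_eq_iff plus_tensor.rep_eq scaleR_tensor.rep_eq)
  moreover have "bij_betw \<gamma> (sym_tensors g) UNIV"
  proof (rule bij_betw_byWitness[where f' = \<delta>])
    show "\<forall>T\<in>sym_tensors g. \<delta> (\<gamma> T) = T"
    proof
      fix T :: "'d option tensor" assume T: "T \<in> sym_tensors g"
      show "\<delta> (\<gamma> T) = T"
      proof (rule tensor_eqI)
        fix js :: "'d option list"
        show "tcoeff (\<delta> (\<gamma> T)) js = tcoeff T js"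
        proof (cases "length js = g")
          case True
          obtain S where S: "T = symm S" using T by (auto simp: sym_tensors_def)
          have "mset (r (inv_idx (count_list js))) = mset js"
            by (simp add: mset_eq_iff_count_list r idx_inv[OF True])
          from symm_cong_mset[OF this, of S] show ?thesis
            using True by (simp add: \<delta>_def \<gamma>_def Tensor_inverse S)
        next
          case False
          then show ?thesis
            using T sym_tensors_subset[of g] by (auto simp: \<delta>_def Tensor_inverse tensors_def)
        qed
      qed
    qed
    show "\<forall>v\<in>UNIV. \<gamma> (\<delta> v) = v"
      by (simp add: \<gamma>_def \<delta>_def Tensor_inverse len_r r inv_idx vec_eq_iff)
  qed (use \<delta>_mem in auto)
  moreover have "\<gamma> (vec_tensor (lift1 x) ^ g) = veronese idx x" for x
    by (simp add: \<gamma>_def veronese_def monom_at_def power_vec_tensor len_r r vec_eq_iff UNIV_option_conv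
        lift1_def prod.reindex)
  ultimately show ?thesis
    by blast
qed

lemma emeasure_empirical_measure:
  assumes "n \<ge> 1" "A \<in> sets borel"
  shows "emeasure (empirical_measure n x) A =
    ennreal (1 / real n) * (\<Sum>i=1..n. emeasure (return borel (x i)) A)"
proof -
  let ?m = "card (x -` A \<inter> {1..n})"
  have "emeasure (empirical_measure n x) A = emeasure (uniform_count_measure {1..n}) (x -` A \<inter> {1..n})"
    unfolding empirical_measure_def using assms
    by (subst emeasure_distr)
      (auto simp: measurable_def space_uniform_count_measure sets_uniform_count_measure)
  also have "\<dots> = ennreal (1 / real n * real ?m)"
    using assms by (subst emeasure_uniform_count_measure) auto
  also have "real ?m = (\<Sum>i=1..n. indicator A (x i))"
    by (simp add: indicator_def of_bool_def sum.If_cases Int_commute vimage_def)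
  also have "ennreal (1 / real n * (\<Sum>i=1..n. indicator A (x i))) =
      ennreal (1 / real n) * (\<Sum>i=1..n. ennreal (indicator A (x i)))"
    by (subst sum_ennreal, simp, rule ennreal_mult) (auto intro: sum_nonneg)
  also have "\<dots> = ennreal (1 / real n) * (\<Sum>i=1..n. emeasure (return borel (x i)) A)"
    using assms by (simp add: ennreal_indicator)
  finally show ?thesis .
qed

end

theory Submission
  imports Defs
begin

text \<open>
  Both identities are linear images of identities between symmetric tensors. On tensors of order
  \<open>2g\<close>, the map \<open>L T = hmat (gamma_gamma idx g T)\<close> is linear and sends the tensor power of
  \<open>lift1 x\<close> to the matrix \<open>outer (veronese idx x) (veronese idx x)\<close> (\<open>gamma_gamma_lift1\<close>). Hence
  both random matrices are averages over \<open>i\<close> of \<open>L (F \<omega>)\<close>, where \<open>F \<omega>\<close> is a symmetric tensor built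
  from the single observation \<open>\<theta> i + \<epsilon> i \<omega>\<close>, and it suffices to find the expectation of \<open>F\<close>.

  A symmetric tensor \<open>T\<close> of order \<open>m\<close> is determined by the homogeneous polynomial
  \<open>v \<mapsto> \<langle>T, v \<otimes> \<dots> \<otimes> v\<rangle>\<close>, here \<open>eval_tensor m T\<close> (\<open>symmetric_tensor_eqI\<close>). This evaluation turns tensor
  products into products of numbers and does not see the symmetrization. With
  \<open>s = v \<bullet> lift1 \<theta>\<close>, the number \<open>v \<bullet> lift1 (\<theta> + \<epsilon>)\<close> is \<open>s + Z\<close> for a centred Gaussian \<open>Z\<close> of
  variance \<open>\<sigma>\<^sup>2 = v \<bullet> (lift0 \<Sigma> *v v)\<close>, so that the two tensor identities become the scalar ones

    \<open>E (s + Z)^(2g) = (\<Sum>k\<le>g. C k * s^(2g-2k) * \<sigma>\<^sup>2^k)\<close>,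
    \<open>E (\<Sum>k\<le>g. (-1)^k * C k * (s + Z)^(2g-2k) * \<sigma>\<^sup>2^k) = s^(2g)\<close>

  with \<open>C k = herm_coeff (2g) k\<close>. The first is the binomial theorem together with the moments of a
  Gaussian. For the second, insert the first: the coefficient of \<open>s^(2g-2r) * \<sigma>\<^sup>2^r\<close> is
  \<open>C r * (\<Sum>k\<le>r. (-1)^k * (r choose k))\<close>, which vanishes for \<open>r > 0\<close> (\<open>herm_coeff_inversion\<close>).
\<close>

section \<open>Symmetric tensors as homogeneous polynomials\<close>

text \<open>
  The polynomial function \<open>v \<mapsto> \<langle>T, v \<otimes> \<dots> \<otimes> v\<rangle>\<close> of the component of order \<open>m\<close> of \<open>T\<close>.
\<close>

definition eval_tensor :: "nat \<Rightarrow> 'i tensor \<Rightarrow> real ^ 'i \<Rightarrow> real" where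
  "eval_tensor m T v = (\<Sum>js | length js = m. tcoeff T js * prod_list (map (($) v) js))"

lemma finite_lists_of_length: "finite {js :: 'i::finite list. length js = m}"
  using finite_lists_length_eq[of "UNIV :: 'i set" m] by simp

lemma eval_tensor_one: "eval_tensor 0 1 v = 1"
  by (simp add: eval_tensor_def one_tensor.rep_eq)

lemma eval_tensor_scaleR: "eval_tensor m (c *\<^sub>R T) v = c * eval_tensor m T v"
  by (simp add: eval_tensor_def scaleR_tensor.rep_eq sum_distrib_left mult.assoc)

lemma eval_tensor_sum: "eval_tensor m (\<Sum>a\<in>A. F a) v = (\<Sum>a\<in>A. eval_tensor m (F a) v)"
  unfolding eval_tensor_def tcoeff_sum sum_distrib_right by (rule sum.swap)

lemma tcoeff_mult_append:
  assumes "S \<in> tensors p" "length js = p"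
  shows "tcoeff (S * T) (js @ ls) = tcoeff S js * tcoeff T ls"
proof -
  have "tcoeff (S * T) (js @ ls)
      = (\<Sum>k\<le>length (js @ ls). if k = p then tcoeff S js * tcoeff T ls else 0)"
    unfolding times_tensor.rep_eq using assms
    by (intro sum.cong refl) (auto simp: tensors_def)
  then show ?thesis using assms by simp
qed

lemma tensors_mult:
  assumes "S \<in> tensors p" "T \<in> tensors q"
  shows "S * T \<in> tensors (p + q)"
proof -
  have "tcoeff S (take k js) * tcoeff T (drop k js) = 0"
    if "length js \<noteq> p + q" "k \<le> length js" for js k
  proof -
    have "length (take k js) \<noteq> p \<or> length (drop k js) \<noteq> q"
      using that by auto
    then show ?thesis
      using assms by (auto simp: tensors_def)
  qed
  then show ?thesis
    by (auto simp: tensors_def times_tensor.rep_eq intro!: sum.neutral)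
qed

lemma tensors_one: "1 \<in> tensors 0"
  by (simp add: tensors_def one_tensor.rep_eq)

lemma tensors_power: "T \<in> tensors p \<Longrightarrow> T ^ k \<in> tensors (p * k)"
  by (induction k) (auto simp: tensors_one intro: tensors_mult)

lemma tensors_vec_tensor: "vec_tensor v \<in> tensors 1"
  by (auto simp: tensors_def vec_tensor.rep_eq split: list.split)

lemma eval_tensor_mult:
  fixes v :: "real ^ 'i::finite"
  assumes S: "S \<in> tensors p"
  shows "eval_tensor (p + q) (S * T) v = eval_tensor p S v * eval_tensor q T v"
proof -
  let ?m = "\<lambda>js. prod_list (map (($) v) js)"
  have "eval_tensor p S v * eval_tensor q T v
      = (\<Sum>(js, ls)\<in>{js. length js = p} \<times> {ls. length ls = q}.
          (tcoeff S js * ?m js) * (tcoeff T ls * ?m ls))"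
    by (simp add: eval_tensor_def sum_product sum.cartesian_product)
  also have "\<dots> = (\<Sum>ks | length ks = p + q. tcoeff (S * T) ks * ?m ks)"
  proof (rule sum.reindex_bij_witness[where i = "\<lambda>ks. (take p ks, drop p ks)"
        and j = "\<lambda>(js, ls). js @ ls"])
    fix a assume "a \<in> {js :: 'i list. length js = p} \<times> {ls :: 'i list. length ls = q}"
    then obtain js ls where a: "a = (js, ls)" "length js = p" "length ls = q"
      by blast
    show "tcoeff (S * T) (case a of (js, ls) \<Rightarrow> js @ ls) * ?m (case a of (js, ls) \<Rightarrow> js @ ls) =
        (case a of (js, ls) \<Rightarrow> (tcoeff S js * ?m js) * (tcoeff T ls * ?m ls))"
      using a by (simp add: tcoeff_mult_append[OF S])
  qed (simp_all add: split_beta mem_Times_iff)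
  also have "\<dots> = eval_tensor (p + q) (S * T) v"
    by (simp only: eval_tensor_def)
  finally show ?thesis
    by (rule sym)
qed

lemma eval_tensor_power:
  fixes v :: "real ^ 'i::finite"
  assumes "T \<in> tensors p"
  shows "eval_tensor (p * k) (T ^ k) v = eval_tensor p T v ^ k"
  by (induction k) (simp_all add: eval_tensor_one eval_tensor_mult[OF assms])

lemma eval_tensor_vec_tensor: "eval_tensor 1 (vec_tensor w) v = v \<bullet> w"
proof -
  have "eval_tensor 1 (vec_tensor w) v = (\<Sum>j\<in>UNIV. w $ j * v $ j)"
    unfolding eval_tensor_def
    by (rule sum.reindex_bij_witness[where i = "\<lambda>j. [j]" and j = hd])
      (auto simp: length_Suc_conv vec_tensor.rep_eq)
  then show ?thesis
    by (simp add: inner_vec_def mult.commute)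
qed

lemma eval_tensor_vec_tensor_power: "eval_tensor m (vec_tensor w ^ m) v = (v \<bullet> w) ^ m"
  using eval_tensor_power[OF tensors_vec_tensor, of m w v] unfolding eval_tensor_vec_tensor by simp

lemma
  shows mat_tensor_in_tensors: "mat_tensor A \<in> tensors 2"
    and hmat_mat_tensor: "hmat (mat_tensor A) = A"
proof -
  have "A \<in> hmat ` tensors 2"
    using bij_betw_imp_surj_on[OF bij_betw_hmat] by blast
  then show "mat_tensor A \<in> tensors 2" "hmat (mat_tensor A) = A"
    unfolding mat_tensor_def by (rule inv_into_into f_inv_into_f)+
qed

lemma eval_tensor_mat_tensor: "eval_tensor 2 (mat_tensor A) v = v \<bullet> (A *v v)"
proof -
  have A: "tcoeff (mat_tensor A) [a, b] = A $ a $ b" for a b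
    by (subst (2) hmat_mat_tensor[symmetric]) (simp add: hmat_def)
  have "eval_tensor 2 (mat_tensor A) v = (\<Sum>(a, b)\<in>UNIV. A $ a $ b * (v $ a * v $ b))"
    unfolding eval_tensor_def
    by (rule sum.reindex_bij_witness[where i = "\<lambda>(a, b). [a, b]" and j = "\<lambda>js. (js ! 0, js ! 1)"])
      (auto simp: A numeral_2_eq_2 length_Suc_conv)
  also have "\<dots> = (\<Sum>a\<in>UNIV. \<Sum>b\<in>UNIV. A $ a $ b * (v $ a * v $ b))"
    by (simp add: sum.cartesian_product)
  finally show ?thesis
    by (simp add: inner_vec_def matrix_vector_mult_def sum_distrib_left ac_simps)
qed

text \<open>
  Permuting the factors of \<open>v \<otimes> \<dots> \<otimes> v\<close> changes nothing, so every term of the average contributes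
  the same value.
\<close>

lemma eval_tensor_symm:
  fixes v :: "real ^ 'i::finite"
  shows "eval_tensor m (symm T) v = eval_tensor m T v"
proof -
  let ?m = "\<lambda>js. prod_list (map (($) v) js)" and ?P = "{\<tau>. \<tau> permutes {..<m}}"
  have "(\<Sum>js | length js = m. tcoeff T (permute_list \<tau> js) * ?m js) = eval_tensor m T v"
    if \<tau>: "\<tau> permutes {..<m}" for \<tau>
    unfolding eval_tensor_def
  proof (rule sum.reindex_bij_witness[where i = "permute_list (inv \<tau>)" and j = "permute_list \<tau>"])
    fix js :: "'i list" assume js: "js \<in> {js. length js = m}"
    show "permute_list (inv \<tau>) (permute_list \<tau> js) = js"
      using js \<tau> by (subst permute_list_compose[symmetric]) (auto simp: permutes_inv_o[OF \<tau>] permutes_inv)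
    show "permute_list \<tau> (permute_list (inv \<tau>) js) = js"
      using js \<tau> by (subst permute_list_compose[symmetric]) (auto simp: permutes_inv_o[OF \<tau>] permutes_inv)
    have "?m (permute_list \<tau> js) = ?m js"
      using js \<tau> by (simp add: permute_list_map[symmetric] flip: prod_mset_prod_list)
    then show "tcoeff T (permute_list \<tau> js) * ?m (permute_list \<tau> js)
        = tcoeff T (permute_list \<tau> js) * ?m js"
      by simp
  qed auto
  then have "(\<Sum>\<tau>\<in>?P. \<Sum>js | length js = m. tcoeff T (permute_list \<tau> js) * ?m js)
      = fact m * eval_tensor m T v"
    by (simp add: card_permutations)
  moreover have "eval_tensor m (symm T) v
      = (\<Sum>js | length js = m. (\<Sum>\<tau>\<in>?P. tcoeff T (permute_list \<tau> js) * ?m js)) / fact m"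
    unfolding eval_tensor_def sum_divide_distrib
    by (intro sum.cong refl) (simp add: symm.rep_eq sum_distrib_right sum_divide_distrib)
  ultimately show ?thesis
    by (subst (asm) sum.swap) simp
qed

text \<open>
  This makes the Kronecker substitution below injective on monomials.
\<close>

lemma digits_unique:
  fixes a b :: "nat \<Rightarrow> nat"
  assumes "\<And>k. k < d \<Longrightarrow> a k < N" "\<And>k. k < d \<Longrightarrow> b k < N"
    and "(\<Sum>k<d. a k * N ^ k) = (\<Sum>k<d. b k * N ^ k)" "k < d"
  shows "a k = b k"
  using assms
proof (induction d arbitrary: a b k)
  case (Suc d)
  have split: "(\<Sum>k<Suc d. c k * N ^ k) = c 0 + N * (\<Sum>k<d. c (Suc k) * N ^ k)" for c :: "nat \<Rightarrow> nat"
    unfolding sum.lessThan_Suc_shift by (simp add: sum_distrib_left ac_simps)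
  have eq: "a 0 + N * (\<Sum>k<d. a (Suc k) * N ^ k) = b 0 + N * (\<Sum>k<d. b (Suc k) * N ^ k)"
    using Suc.prems(3) by (simp only: split)
  have small: "a 0 < N" "b 0 < N"
    using Suc.prems(1,2) by auto
  have "a 0 = b 0"
    using arg_cong[OF eq, of "\<lambda>x. x mod N"] small by simp
  moreover have "(\<Sum>k<d. a (Suc k) * N ^ k) = (\<Sum>k<d. b (Suc k) * N ^ k)"
    using eq \<open>a 0 = b 0\<close> small by simp
  then have "a (Suc k) = b (Suc k)" if "k < d" for k
    using Suc.prems(1,2) that by (intro Suc.IH[of "\<lambda>k. a (Suc k)" "\<lambda>k. b (Suc k)"]) auto
  ultimately show ?case
    using Suc.prems(4) by (cases k) auto
qed simp

text \<open>
  Compared with membership in \<open>sym_tensors m\<close>, this pointwise description passes directly to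
  expectations that are taken coefficient by coefficient.
\<close>

definition symmetric_tensor :: "'i tensor \<Rightarrow> bool" where
  "symmetric_tensor T \<longleftrightarrow> (\<forall>js ls. mset js = mset ls \<longrightarrow> tcoeff T js = tcoeff T ls)"

text \<open>
  The Kronecker substitution: if the indices get the weights \<open>1, N, N\<^sup>2, \<dots>\<close> with \<open>N = m + 1\<close>, then
  the total weight of a list of length \<open>m\<close> has the multiplicities of its entries as base \<open>N\<close> digits.
\<close>

lemma ex_separating_weight:
  "\<exists>w :: 'i::finite \<Rightarrow> nat. \<forall>js ls. length js = m \<longrightarrow> length ls = m \<longrightarrow>
     sum_list (map w js) = sum_list (map w ls) \<longrightarrow> mset js = mset ls"
proof -
  obtain e :: "'i \<Rightarrow> nat" where e: "bij_betw e UNIV {0..<CARD('i)}"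
    using ex_bij_betw_finite_nat[of "UNIV :: 'i set"] by auto
  define w where "w i = Suc m ^ e i" for i
  define e' where "e' = inv_into UNIV e"
  have e'e: "e' (e i) = i" for i
    using bij_betw_imp_inj_on[OF e] by (simp add: e'_def)
  have ee': "e (e' k) = k" if "k < CARD('i)" for k
    using that bij_betw_imp_surj_on[OF e] by (simp add: e'_def f_inv_into_f)
  have weight: "sum_list (map w js) = (\<Sum>k<CARD('i). count_list js (e' k) * Suc m ^ k)" for js
  proof -
    have "sum_list (map w js) = (\<Sum>i\<in>UNIV. count_list js i * w i)"
      by (subst sum_list_map_eq_sum_count2[of js UNIV]) auto
    also have "\<dots> = (\<Sum>k<CARD('i). count_list js (e' k) * Suc m ^ k)"
      by (rule sum.reindex_bij_witness[where i = e' and j = e])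
        (use bij_betw_apply[OF e] in \<open>auto simp: e'e ee' w_def\<close>)
    finally show ?thesis .
  qed
  have "mset js = mset ls"
    if prems: "length js = m" "length ls = m" "sum_list (map w js) = sum_list (map w ls)" for js ls
  proof -
    have "count_list js (e' k) = count_list ls (e' k)" if "k < CARD('i)" for k
      by (rule digits_unique[where N = "Suc m" and d = "CARD('i)" and k = k
            and a = "\<lambda>k. count_list js (e' k)" and b = "\<lambda>k. count_list ls (e' k)"])
        (use that prems count_le_length[of js] count_le_length[of ls] in \<open>auto simp: less_Suc_eq_le weight\<close>)
    then have "count_list js i = count_list ls i" for i
      using bij_betw_apply[OF e, of i] by (metis UNIV_I atLeastLessThan_iff e'e)
    then show ?thesis
      by (auto simp: mset_eq_iff_count_list)
  qed
  then show ?thesis by blast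
qed

text \<open>
  Along the curve \<open>t \<mapsto> (t ^ w i)\<^sub>i\<close> with separating weights \<open>w\<close>, the evaluations are
  polynomials in one variable, and distinct monomials of degree \<open>m\<close> become distinct powers of \<open>t\<close>.
  The coefficient of \<open>t ^ W ls\<close> is therefore the sum of the entries over all rearrangements of \<open>ls\<close>,
  which for a symmetric tensor is a positive multiple of its entry at \<open>ls\<close>.
\<close>

lemma symmetric_tensor_eqI:
  fixes S T :: "'i::finite tensor"
  assumes S: "S \<in> tensors m" "symmetric_tensor S" and T: "T \<in> tensors m" "symmetric_tensor T"
    and eq: "\<And>v. eval_tensor m S v = eval_tensor m T v"
  shows "S = T"
proof (rule tensor_eqI)
  fix ls :: "'i list"
  obtain w :: "'i \<Rightarrow> nat" where w: "\<forall>js ls. length js = m \<longrightarrow> length ls = m \<longrightarrow>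
     sum_list (map w js) = sum_list (map w ls) \<longrightarrow> mset js = mset ls"
    using ex_separating_weight by (rule exE)
  define W where "W js = sum_list (map w js)" for js
  let ?L = "{js :: 'i list. length js = m}"
  define D where "D js = tcoeff S js - tcoeff T js" for js
  define n where "n = Max (W ` ?L)"
  have W_le: "W js \<le> n" if "js \<in> ?L" for js
    unfolding n_def by (rule Max_ge) (use that finite_lists_of_length in auto)
  define c where "c r = (\<Sum>js | js \<in> ?L \<and> W js = r. D js)" for r
  have "(\<Sum>r\<le>n. c r * t ^ r) = 0" for t :: real
  proof -
    let ?v = "(\<chi> i. t ^ w i) :: real ^ 'i"
    have mon: "prod_list (map (($) ?v) js) = t ^ W js" for js
      by (induction js) (simp_all add: W_def power_add)
    have "(\<Sum>r\<le>n. c r * t ^ r) = (\<Sum>r\<le>n. \<Sum>js | js \<in> ?L \<and> W js = r. D js * t ^ W js)"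
      unfolding c_def sum_distrib_right by (intro sum.cong refl) auto
    also have "\<dots> = (\<Sum>js\<in>?L. D js * t ^ W js)"
      using W_le by (intro sum.group finite_lists_of_length) auto
    also have "\<dots> = eval_tensor m S ?v - eval_tensor m T ?v"
      by (simp add: eval_tensor_def mon D_def left_diff_distrib sum_subtractf)
    finally show ?thesis by (simp add: eq)
  qed
  then have c0: "c r = 0" if "r \<le> n" for r
    using polyfun_eq_0[of c n] that by blast
  show "tcoeff S ls = tcoeff T ls"
  proof (cases "length ls = m")
    case True
    have same: "D js = D ls" if "js \<in> ?L" "W js = W ls" for js
    proof -
      have "mset js = mset ls"
        using w that True unfolding W_def by blast
      then have "tcoeff S js = tcoeff S ls" "tcoeff T js = tcoeff T ls"
        using S(2) T(2) unfolding symmetric_tensor_def by blast+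
      then show ?thesis
        by (simp add: D_def)
    qed
    \<comment> \<open>All lists of the same weight as \<open>ls\<close> are rearrangements of it, so that \<open>D\<close> is constant on them.\<close>
    have "c (W ls) = real (card {js. js \<in> ?L \<and> W js = W ls}) * D ls"
      unfolding c_def using same by simp
    moreover have "card {js. js \<in> ?L \<and> W js = W ls} \<noteq> 0"
    proof -
      have "finite {js. js \<in> ?L \<and> W js = W ls}"
        by (rule finite_subset[OF _ finite_lists_of_length[of m]]) auto
      moreover have "ls \<in> {js. js \<in> ?L \<and> W js = W ls}"
        using True by simp
      ultimately show ?thesis
        by (subst card_0_eq) blast+
    qed
    ultimately have "D ls = 0"
      using c0[of "W ls"] W_le True by simp
    then show ?thesis by (simp add: D_def)
  next
    case False
    then show ?thesis using S(1) T(1) by (simp add: tensors_def)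
  qed
qed

lemma symmetric_tensor_symm: "symmetric_tensor (symm T)"
  unfolding symmetric_tensor_def using symm_cong_mset by blast

lemma symmetric_tensor_scaleR: "symmetric_tensor T \<Longrightarrow> symmetric_tensor (c *\<^sub>R T)"
  unfolding symmetric_tensor_def scaleR_tensor.rep_eq mult_cancel_left by blast

lemma symmetric_tensor_sum: "(\<And>a. a \<in> A \<Longrightarrow> symmetric_tensor (F a)) \<Longrightarrow> symmetric_tensor (\<Sum>a\<in>A. F a)"
  unfolding symmetric_tensor_def tcoeff_sum by (intro allI impI sum.cong refl) blast

lemma symmetric_tensor_vec_power:
  fixes v :: "real ^ 'i::finite"
  shows "symmetric_tensor (vec_tensor v ^ m)"
  unfolding symmetric_tensor_def
proof (intro allI impI)
  fix js ls :: "'i list" assume eq: "mset js = mset ls"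
  from eq have "count_list js = count_list ls"
    by (simp only: mset_eq_iff_count_list)
  with mset_eq_length[OF eq] show "tcoeff (vec_tensor v ^ m) js = tcoeff (vec_tensor v ^ m) ls"
    by (simp only: power_vec_tensor)
qed

lemma tensors_symm: "T \<in> tensors m \<Longrightarrow> symm T \<in> tensors m"
  by (auto simp: tensors_def symm.rep_eq)

lemma tensors_scaleR: "T \<in> tensors m \<Longrightarrow> c *\<^sub>R T \<in> tensors m"
  by (auto simp: tensors_def scaleR_tensor.rep_eq)

lemma tensors_sum: "(\<And>a. a \<in> A \<Longrightarrow> F a \<in> tensors m) \<Longrightarrow> (\<Sum>a\<in>A. F a) \<in> tensors m"
  by (auto simp: tensors_def tcoeff_sum intro!: sum.neutral)

lemma vec_tensor_power_in_tensors: "vec_tensor v ^ m \<in> tensors m"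
  using tensors_power[OF tensors_vec_tensor, of v m] by simp

lemma vec_tensor_power_in_sym_tensors:
  fixes v :: "real ^ 'i::finite"
  shows "vec_tensor v ^ m \<in> sym_tensors m"
proof -
  have "vec_tensor v ^ m = symm (vec_tensor v ^ m)"
    by (rule symmetric_tensor_eqI[where m = m])
      (simp_all add: vec_tensor_power_in_tensors tensors_symm symmetric_tensor_vec_power
        symmetric_tensor_symm eval_tensor_symm)
  then show ?thesis
    using vec_tensor_power_in_tensors unfolding sym_tensors_def by blast
qed

section \<open>The Veronese matrix as a linear image of a tensor power\<close>

lemma
  fixes idx :: "'b::finite \<Rightarrow> 'd::finite option \<Rightarrow> nat"
  assumes "bij_betw idx UNIV (multi_indices g)"
  shows linear_gamma_map: "linear (gamma_map idx g)"
    and gamma_map_lift1: "gamma_map idx g (vec_tensor (lift1 x) ^ g) = veronese idx x"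
  using someI_ex[OF gamma_map_exists[OF assms], folded gamma_map_def] by blast+

text \<open>
  Since \<open>(lift1 x)\<^sup>\<otimes>\<^sup>2\<^sup>g = (lift1 x)\<^sup>\<otimes>\<^sup>g \<otimes> (lift1 x)\<^sup>\<otimes>\<^sup>g\<close> with both factors symmetric, the defining
  property of the tensor product of maps gives the value on such powers.
\<close>

lemma
  fixes idx :: "'b::finite \<Rightarrow> 'd::finite option \<Rightarrow> nat"
  assumes idx: "bij_betw idx UNIV (multi_indices g)"
  shows linear_gamma_gamma: "linear (gamma_gamma idx g)"
    and gamma_gamma_lift1: "hmat (gamma_gamma idx g (vec_tensor (lift1 x) ^ (2 * g)))
      = outer (veronese idx x) (veronese idx x)"
proof -
  let ?V = "sym_tensors g :: 'd option tensor set"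
  have *: "linear (gamma_gamma idx g) \<and> (\<forall>S\<in>?V. \<forall>T\<in>?V.
      gamma_gamma idx g (S * T) = vec_tensor (gamma_map idx g S) * vec_tensor (gamma_map idx g T))"
    unfolding gamma_gamma_def tensor_map_def
    by (rule someI_ex[OF tensor_map_exists])
      (rule linear_gamma_map[OF idx] sym_tensors_subset)+
  then show "linear (gamma_gamma idx g)" by blast
  have "vec_tensor (lift1 x) ^ (2 * g) = vec_tensor (lift1 x) ^ g * vec_tensor (lift1 x) ^ g"
    by (simp add: mult_2 power_add)
  then show "hmat (gamma_gamma idx g (vec_tensor (lift1 x) ^ (2 * g)))
      = outer (veronese idx x) (veronese idx x)"
    using * vec_tensor_power_in_sym_tensors[of "lift1 x" g]
    by (simp add: gamma_map_lift1[OF idx] hmat_vec_tensor)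
qed

lemma linear_hmat_gamma_gamma:
  assumes "bij_betw idx UNIV (multi_indices g)"
  shows "linear (\<lambda>T. hmat (gamma_gamma idx g T))"
  using linear_compose[OF linear_gamma_gamma[OF assms] linear_hmat] by (simp add: o_def)

section \<open>Gaussian moments and the Hermite coefficients\<close>

lemma herm_coeff_conv_fact:
  assumes "2 * k \<le> m"
  shows "herm_coeff m k = fact m / (fact (m - 2 * k) * fact k * 2 ^ k)"
  using binomial_fact[OF assms, where 'a = real] by (simp add: herm_coeff_def divide_simps)

text \<open>
  \<open>herm_coeff m k\<close> is the number of sets of \<open>k\<close> disjoint pairs among \<open>m\<close> objects. Choosing \<open>k\<close> pairs
  and then \<open>l\<close> further ones amounts to choosing \<open>k + l\<close> pairs and marking \<open>k\<close> of them.
\<close>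

lemma herm_coeff_mult:
  assumes "2 * (k + l) \<le> m"
  shows "herm_coeff m k * herm_coeff (m - 2 * k) l = herm_coeff m (k + l) * real ((k + l) choose k)"
proof -
  have "real ((k + l) choose k) = fact (k + l) / (fact k * fact l)"
    by (simp add: binomial_fact)
  moreover have "m - 2 * k - 2 * l = m - 2 * (k + l)"
    by simp
  ultimately show ?thesis
    using assms by (simp add: herm_coeff_conv_fact divide_simps power_add)
qed

text \<open>
  Averaging over a Gaussian and forming Hermite polynomials are inverse to each other: after
  collecting the terms with \<open>k + l = r\<close>, an alternating sum of binomial coefficients
  \<open>r choose k\<close> remains, and only \<open>r = 0\<close> survives.
\<close>

lemma herm_coeff_inversion:
  fixes s v :: real
  shows "(\<Sum>k\<le>g. herm_coeff (2 * g) k * (-1) ^ k * v ^ k *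
      (\<Sum>l\<le>g - k. herm_coeff (2 * (g - k)) l * s ^ (2 * (g - k) - 2 * l) * v ^ l)) = s ^ (2 * g)"
proof -
  let ?h = "herm_coeff (2 * g)"
  let ?f = "\<lambda>k l. (-1) ^ k * real ((k + l) choose k) * (?h (k + l) * s ^ (2 * (g - (k + l))) * v ^ (k + l))"
  have "(\<Sum>k\<le>g. ?h k * (-1) ^ k * v ^ k *
      (\<Sum>l\<le>g - k. herm_coeff (2 * (g - k)) l * s ^ (2 * (g - k) - 2 * l) * v ^ l)) =
      (\<Sum>k\<le>g. \<Sum>l\<le>g - k. ?f k l)"
    unfolding sum_distrib_left
  proof (intro sum.cong refl)
    fix k l assume kl: "k \<in> {..g}" "l \<in> {..g - k}"
    have "?h k * herm_coeff (2 * (g - k)) l = ?h (k + l) * real ((k + l) choose k)"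
      using herm_coeff_mult[of k l "2 * g"] kl by (simp add: diff_mult_distrib2)
    moreover have "2 * (g - k) - 2 * l = 2 * (g - (k + l))"
      by simp
    ultimately show "?h k * (-1) ^ k * v ^ k *
        (herm_coeff (2 * (g - k)) l * s ^ (2 * (g - k) - 2 * l) * v ^ l) = ?f k l"
      by (simp only: power_add) (simp add: mult_ac)
  qed
  also have "\<dots> = (\<Sum>r\<le>g. \<Sum>k\<le>r. ?f k (r - k))"
    by (rule sum_splits_assoc[symmetric])
  also have "\<dots> = (\<Sum>r\<le>g. ?h r * s ^ (2 * (g - r)) * v ^ r * (\<Sum>k\<le>r. (-1) ^ k * real (r choose k)))"
    unfolding sum_distrib_left by (intro sum.cong refl) (auto simp: mult_ac)
  also have "\<dots> = (\<Sum>r\<le>g. if r = 0 then s ^ (2 * g) else 0)"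
    using choose_alternating_sum[where 'a = real] by (intro sum.cong refl) (auto simp: herm_coeff_def)
  finally show ?thesis by simp
qed

lemma normal_measure_moment:
  assumes "0 \<le> v"
  shows "has_bochner_integral (normal_measure 0 v) (\<lambda>x. x ^ j)
    (if even j then fact j / (fact (j div 2) * 2 ^ (j div 2)) * v ^ (j div 2) else 0)"
proof (cases "v = 0")
  case True
  have "has_bochner_integral (return borel (0::real)) (\<lambda>x. x ^ j) (0 ^ j)"
    by (simp add: has_bochner_integral_iff integral_return integrable_iff_bounded nn_integral_return)
  moreover have "(if even j then fact j / (fact (j div 2) * 2 ^ (j div 2)) * v ^ (j div 2) else 0) = (0::real) ^ j"
    using True by (cases "j = 0") (auto simp: power_0_left elim!: evenE)
  ultimately show ?thesis
    using True by (simp add: normal_measure_def)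
next
  case False
  with assms have v: "0 < v" by simp
  have "has_bochner_integral lborel (\<lambda>x. normal_density 0 (sqrt v) x * x ^ j)
    (if even j then fact j / (fact (j div 2) * 2 ^ (j div 2)) * v ^ (j div 2) else 0)"
  proof (cases "even j")
    case True
    then obtain k where "j = 2 * k" by (rule evenE)
    then show ?thesis
      using normal_moment_even[of "sqrt v" 0 k] v by (simp add: power_divide mult_ac)
  next
    case False
    then obtain k where "j = 2 * k + 1" by (rule oddE)
    then show ?thesis
      using normal_moment_odd[of "sqrt v" 0 k] v by simp
  qed
  then show ?thesis
    using False by (auto simp: normal_measure_def intro!: has_bochner_integral_density)
qed

lemma normal_measure_shifted_moment:
  assumes "0 \<le> v"
  shows "has_bochner_integral (normal_measure 0 v) (\<lambda>x. (s + x) ^ (2 * h))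
    (\<Sum>k\<le>h. herm_coeff (2 * h) k * s ^ (2 * h - 2 * k) * v ^ k)"
proof -
  let ?\<mu> = "\<lambda>j. if even j then fact j / (fact (j div 2) * 2 ^ (j div 2)) * v ^ (j div 2) else 0 :: real"
  let ?c = "\<lambda>j. real (2 * h choose j) * ?\<mu> j * s ^ (2 * h - j)"
  have "has_bochner_integral (normal_measure 0 v)
      (\<lambda>x. \<Sum>j\<le>2 * h. real (2 * h choose j) * x ^ j * s ^ (2 * h - j)) (\<Sum>j\<le>2 * h. ?c j)"
    by (intro has_bochner_integral_sum has_bochner_integral_mult_left has_bochner_integral_mult_right
        normal_measure_moment assms)
  also have "(\<lambda>x. \<Sum>j\<le>2 * h. real (2 * h choose j) * x ^ j * s ^ (2 * h - j)) = (\<lambda>x. (s + x) ^ (2 * h))"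
    by (simp add: binomial_ring add.commute[of s])
  \<comment> \<open>The odd moments vanish.\<close>
  also have "(\<Sum>j\<le>2 * h. ?c j) = (\<Sum>j\<in>(*) 2 ` {..h}. ?c j)"
    by (rule sum.mono_neutral_right) (auto elim!: evenE)
  also have "\<dots> = (\<Sum>k\<le>h. ?c (2 * k))"
    by (simp add: sum.reindex inj_on_def)
  also have "\<dots> = (\<Sum>k\<le>h. herm_coeff (2 * h) k * s ^ (2 * h - 2 * k) * v ^ k)"
    by (rule sum.cong) (simp_all add: herm_coeff_def)
  finally show ?thesis .
qed

section \<open>Expectations of linear images of random tensors\<close>

lemma linear_eval_tensor: "linear (\<lambda>T. eval_tensor m T v)"
proof (rule linearI)
  show "eval_tensor m (S + T) v = eval_tensor m S v + eval_tensor m T v" for S T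
    by (simp add: eval_tensor_def plus_tensor.rep_eq distrib_right sum.distrib)
qed (simp add: eval_tensor_scaleR)

lemma linear_tcoeff: "linear (\<lambda>T. tcoeff T js)"
  by (rule linearI) (simp_all add: plus_tensor.rep_eq scaleR_tensor.rep_eq)

definition tensor_expectation :: "'w measure \<Rightarrow> ('w \<Rightarrow> 'i tensor) \<Rightarrow> 'i tensor" where
  "tensor_expectation M F = Tensor (\<lambda>js. \<integral>\<omega>. tcoeff (F \<omega>) js \<partial>M)"

lemma tensor_basis_expansion:
  fixes T :: "'i::finite tensor"
  assumes "T \<in> tensors m"
  shows "T = (\<Sum>js | length js = m. tcoeff T js *\<^sub>R Tensor (\<lambda>ls. of_bool (ls = js)))"
proof (rule tensor_eqI)
  fix ls
  have "(\<Sum>js | length js = m. tcoeff T js * of_bool (ls = js))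
      = (\<Sum>js | length js = m. if js = ls then tcoeff T ls else 0)"
    by (rule sum.cong) auto
  also have "\<dots> = tcoeff T ls"
    using assms by (simp add: finite_lists_of_length tensors_def)
  finally show "tcoeff T ls
      = tcoeff (\<Sum>js | length js = m. tcoeff T js *\<^sub>R Tensor (\<lambda>ls. of_bool (ls = js))) ls"
    by (simp add: tcoeff_sum scaleR_tensor.rep_eq Tensor_inverse)
qed

text \<open>
  On tensors of a fixed order, a linear map depends on finitely many coefficients only and thus
  commutes with the expectation, although the type of all tensors is infinite-dimensional.
\<close>

lemma has_bochner_integral_linear_tensor:
  fixes F :: "'w \<Rightarrow> 'i::finite tensor"
    and L :: "'i tensor \<Rightarrow> 'c::{banach, second_countable_topology}"
  assumes L: "linear L"
    and F: "\<And>\<omega>. F \<omega> \<in> tensors m" "\<And>js. integrable M (\<lambda>\<omega>. tcoeff (F \<omega>) js)"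
  shows "has_bochner_integral M (\<lambda>\<omega>. L (F \<omega>)) (L (tensor_expectation M F))"
proof -
  define B where "B js = L (Tensor (\<lambda>ls. of_bool (ls = js)))" for js :: "'i list"
  have L_eq: "L T = (\<Sum>js | length js = m. tcoeff T js *\<^sub>R B js)" if "T \<in> tensors m" for T
    by (subst tensor_basis_expansion[OF that]) (simp add: linear_sum[OF L] linear_scale[OF L] B_def)
  have "tensor_expectation M F \<in> tensors m"
    using F(1) by (simp add: tensors_def tensor_expectation_def Tensor_inverse)
  then have "L (tensor_expectation M F)
      = (\<Sum>js | length js = m. (\<integral>\<omega>. tcoeff (F \<omega>) js \<partial>M) *\<^sub>R B js)"
    by (simp add: L_eq tensor_expectation_def Tensor_inverse)
  then show ?thesis
    using F by (auto simp: L_eq intro!: has_bochner_integral_sum has_bochner_integral_scaleR_left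
        has_bochner_integral_integrable)
qed

text \<open>
  The expectation of a random symmetric tensor can be identified by testing against \<open>v \<otimes> \<dots> \<otimes> v\<close>,
  which reduces the tensor identities to scalar ones.
\<close>

lemma has_bochner_integral_symmetric_tensor:
  fixes F :: "'w \<Rightarrow> 'i::finite tensor"
    and L :: "'i tensor \<Rightarrow> 'c::{banach, second_countable_topology}"
  assumes L: "linear L"
    and F: "\<And>\<omega>. F \<omega> \<in> tensors m" "\<And>\<omega>. symmetric_tensor (F \<omega>)"
      "\<And>js. integrable M (\<lambda>\<omega>. tcoeff (F \<omega>) js)"
    and E: "E \<in> tensors m" "symmetric_tensor E"
      "\<And>v. has_bochner_integral M (\<lambda>\<omega>. eval_tensor m (F \<omega>) v) (eval_tensor m E v)"
  shows "has_bochner_integral M (\<lambda>\<omega>. L (F \<omega>)) (L E)"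
proof -
  have "tensor_expectation M F = E"
  proof (rule symmetric_tensor_eqI)
    show "tensor_expectation M F \<in> tensors m"
      using F(1) by (simp add: tensors_def tensor_expectation_def Tensor_inverse)
    show "symmetric_tensor (tensor_expectation M F)"
      unfolding symmetric_tensor_def
    proof (intro allI impI)
      fix js ls :: "'i list" assume "mset js = mset ls"
      then have "tcoeff (F \<omega>) js = tcoeff (F \<omega>) ls" for \<omega>
        using F(2)[of \<omega>] unfolding symmetric_tensor_def by blast
      then show "tcoeff (tensor_expectation M F) js = tcoeff (tensor_expectation M F) ls"
        by (simp add: tensor_expectation_def Tensor_inverse)
    qed
    show "eval_tensor m (tensor_expectation M F) v = eval_tensor m E v" for v
      by (rule has_bochner_integral_eq[OF has_bochner_integral_linear_tensor E(3)])
        (use F linear_eval_tensor in auto)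
  qed (use E in auto)
  then show ?thesis
    using has_bochner_integral_linear_tensor[OF L F(1,3)] by simp
qed

section \<open>Tensor powers of a Gaussian vector\<close>

text \<open>
  Each factor is bounded by the entry of largest modulus. This reduces the integrability of mixed
  moments to that of moments of single coordinates.
\<close>

lemma abs_monomial_le_sum_power:
  fixes w :: "real ^ 'i::finite"
  shows "\<bar>\<Prod>j\<in>UNIV. (w $ j) ^ c j\<bar> \<le> (\<Sum>j\<in>UNIV. \<bar>w $ j\<bar> ^ (\<Sum>j\<in>UNIV. c j))"
proof -
  have "Max (range (\<lambda>j. \<bar>w $ j\<bar>)) \<in> range (\<lambda>j. \<bar>w $ j\<bar>)"
    by (rule Max_in) auto
  then obtain i where i: "Max (range (\<lambda>j. \<bar>w $ j\<bar>)) = \<bar>w $ i\<bar>"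
    by (rule imageE)
  have le: "\<bar>w $ j\<bar> \<le> \<bar>w $ i\<bar>" for j
    unfolding i[symmetric] by (rule Max_ge) auto
  have "\<bar>\<Prod>j\<in>UNIV. (w $ j) ^ c j\<bar> \<le> (\<Prod>j\<in>UNIV. \<bar>w $ i\<bar> ^ c j)"
    unfolding abs_prod power_abs by (intro prod_mono conjI power_mono le) auto
  also have "\<dots> = \<bar>w $ i\<bar> ^ (\<Sum>j\<in>UNIV. c j)"
    by (simp add: power_sum)
  also have "\<dots> \<le> (\<Sum>j\<in>UNIV. \<bar>w $ j\<bar> ^ (\<Sum>j\<in>UNIV. c j))"
    by (rule member_le_sum) auto
  finally show ?thesis .
qed

lemma inner_lift1_add: "v \<bullet> lift1 (x + y) = v \<bullet> lift1 x + (\<chi> i. v $ Some i) \<bullet> y"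
  by (simp add: inner_vec_def lift1_def UNIV_option_conv sum.reindex sum.distrib algebra_simps)

lemma lift0_quadratic_form:
  "v \<bullet> (lift0 A *v v) = (\<chi> i. v $ Some i) \<bullet> (A *v (\<chi> i. v $ Some i))"
  by (simp add: inner_vec_def matrix_vector_mult_def lift0_def UNIV_option_conv sum.reindex)

text \<open>
  The scalar form of the first identity. Only the coordinates of \<open>v\<close> other than \<open>None\<close> meet the
  noise, so \<open>v \<bullet> lift1 (\<theta> + \<epsilon>)\<close> is a shift of the one-dimensional projection of \<open>\<epsilon>\<close> on those coordinates.
\<close>

lemma has_bochner_integral_gaussian_projection_power:
  fixes \<epsilon> :: "'w \<Rightarrow> real ^ 'd::finite"
  assumes meas: "\<epsilon> \<in> borel_measurable M"
    and normal: "is_normal 0 \<Sigma> (distr M borel \<epsilon>)" and nonneg: "nonneg_definite \<Sigma>"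
  shows "has_bochner_integral M (\<lambda>\<omega>. (v \<bullet> lift1 (\<theta> + \<epsilon> \<omega>)) ^ (2 * h))
    (\<Sum>k\<le>h. herm_coeff (2 * h) k * (v \<bullet> lift1 \<theta>) ^ (2 * h - 2 * k) * (v \<bullet> (lift0 \<Sigma> *v v)) ^ k)"
proof -
  define u where "u = (\<chi> i. v $ Some i)"
  have "distr M borel (\<lambda>\<omega>. u \<bullet> \<epsilon> \<omega>) = distr (distr M borel \<epsilon>) borel (\<lambda>y. u \<bullet> y)"
    using meas by (subst distr_distr) (auto simp: o_def)
  also have "\<dots> = normal_measure 0 (u \<bullet> (\<Sigma> *v u))"
    using normal by (simp add: is_normal_def)
  finally have "has_bochner_integral (distr M borel (\<lambda>\<omega>. u \<bullet> \<epsilon> \<omega>)) (\<lambda>x. (v \<bullet> lift1 \<theta> + x) ^ (2 * h))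
    (\<Sum>k\<le>h. herm_coeff (2 * h) k * (v \<bullet> lift1 \<theta>) ^ (2 * h - 2 * k) * (u \<bullet> (\<Sigma> *v u)) ^ k)"
    using normal_measure_shifted_moment nonneg by (simp add: nonneg_definite_def)
  then show ?thesis
    using meas
    by (simp add: has_bochner_integral_iff integrable_distr_eq integral_distr inner_lift1_add
        lift0_quadratic_form flip: u_def)
qed

lemma integrable_tcoeff_gaussian_power:
  fixes \<epsilon> :: "'w \<Rightarrow> real ^ 'd::finite"
  assumes [measurable]: "\<epsilon> \<in> borel_measurable M"
    and normal: "is_normal 0 \<Sigma> (distr M borel \<epsilon>)" and nonneg: "nonneg_definite \<Sigma>"
  shows "integrable M (\<lambda>\<omega>. tcoeff (vec_tensor (lift1 (\<theta> + \<epsilon> \<omega>)) ^ (2 * h)) js)"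
proof (cases "length js = 2 * h")
  case True
  let ?w = "\<lambda>\<omega>. lift1 (\<theta> + \<epsilon> \<omega>)"
  have [measurable]: "(\<lambda>\<omega>. ?w \<omega> $ j) \<in> borel_measurable M" for j
    using borel_measurable_inner[of "\<lambda>_. axis _ 1" M "\<lambda>\<omega>. \<theta> + \<epsilon> \<omega>"]
    by (cases j) (simp_all add: lift1_def inner_axis')
  have len: "(\<Sum>j\<in>UNIV. count_list js j) = 2 * h"
    by (subst sum_count_set) (use True in auto)
  have "integrable M (\<lambda>\<omega>. \<Sum>j\<in>UNIV. \<bar>?w \<omega> $ j\<bar> ^ (2 * h))"
  proof (rule Bochner_Integration.integrable_sum)
    \<comment> \<open>A coordinate is the projection on a unit vector; the even power absorbs the modulus.\<close>
    fix j
    show "integrable M (\<lambda>\<omega>. \<bar>?w \<omega> $ j\<bar> ^ (2 * h))"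
      using has_bochner_integral_gaussian_projection_power[OF assms, of "axis j 1" \<theta> h]
      by (simp add: has_bochner_integral_iff inner_axis' power_even_abs)
  qed
  then have "integrable M (\<lambda>\<omega>. \<Prod>j\<in>UNIV. (?w \<omega> $ j) ^ count_list js j)"
  proof (rule Bochner_Integration.integrable_bound)
    show "AE \<omega> in M. norm (\<Prod>j\<in>UNIV. (?w \<omega> $ j) ^ count_list js j)
        \<le> norm (\<Sum>j\<in>UNIV. \<bar>?w \<omega> $ j\<bar> ^ (2 * h))"
      using order_trans[OF abs_monomial_le_sum_power abs_ge_self, of "?w _" "count_list js"]
      unfolding len real_norm_def by (intro AE_I2)
  qed measurable
  then show ?thesis
    using True by (simp add: power_vec_tensor)
qed (simp add: power_vec_tensor)

lemma vec_mat_power_in_tensors: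
  assumes "k \<le> h"
  shows "vec_tensor a ^ (2 * h - 2 * k) * mat_tensor A ^ k \<in> tensors (2 * h)"
  using tensors_mult[OF vec_tensor_power_in_tensors tensors_power[OF mat_tensor_in_tensors],
      of a "2 * h - 2 * k" A k] assms
  by simp

lemma eval_tensor_symm_vec_mat_power:
  fixes v :: "real ^ 'i::finite"
  assumes "k \<le> h"
  shows "eval_tensor (2 * h) (symm (vec_tensor a ^ (2 * h - 2 * k) * mat_tensor A ^ k)) v =
    (v \<bullet> a) ^ (2 * h - 2 * k) * (v \<bullet> (A *v v)) ^ k"
  using eval_tensor_mult[OF vec_tensor_power_in_tensors,
      of "2 * h - 2 * k" "2 * k" a "mat_tensor A ^ k" v] assms
  by (simp add: eval_tensor_symm eval_tensor_vec_tensor_power eval_tensor_mat_tensor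
      eval_tensor_power[OF mat_tensor_in_tensors])

text \<open>
  Isserlis' theorem for the even moments of a non-centred Gaussian vector, in tensor form.
\<close>

lemma has_bochner_integral_gaussian_tensor_power:
  fixes \<epsilon> :: "'w \<Rightarrow> real ^ 'd::finite"
    and L :: "'d option tensor \<Rightarrow> 'c::{banach, second_countable_topology}"
  assumes gauss: "\<epsilon> \<in> borel_measurable M" "is_normal 0 \<Sigma> (distr M borel \<epsilon>)" "nonneg_definite \<Sigma>"
    and L: "linear L"
  shows "has_bochner_integral M (\<lambda>\<omega>. L (vec_tensor (lift1 (\<theta> + \<epsilon> \<omega>)) ^ (2 * g)))
    (\<Sum>k=0..g. herm_coeff (2 * g) k *\<^sub>R
      L (symm (vec_tensor (lift1 \<theta>) ^ (2 * g - 2 * k) * mat_tensor (lift0 \<Sigma>) ^ k)))"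
proof -
  define E where "E = (\<Sum>k=0..g. herm_coeff (2 * g) k *\<^sub>R
      symm (vec_tensor (lift1 \<theta>) ^ (2 * g - 2 * k) * mat_tensor (lift0 \<Sigma>) ^ k))"
  have "has_bochner_integral M (\<lambda>\<omega>. L (vec_tensor (lift1 (\<theta> + \<epsilon> \<omega>)) ^ (2 * g))) (L E)"
  proof (rule has_bochner_integral_symmetric_tensor[OF L])
    show "E \<in> tensors (2 * g)"
      unfolding E_def by (intro tensors_sum tensors_scaleR tensors_symm vec_mat_power_in_tensors) simp
    show "symmetric_tensor E"
      unfolding E_def by (intro symmetric_tensor_sum symmetric_tensor_scaleR symmetric_tensor_symm)
    show "has_bochner_integral M (\<lambda>\<omega>. eval_tensor (2 * g) (vec_tensor (lift1 (\<theta> + \<epsilon> \<omega>)) ^ (2 * g)) v)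
        (eval_tensor (2 * g) E v)" for v
      using has_bochner_integral_gaussian_projection_power[OF gauss, of v \<theta> g]
      by (simp add: E_def eval_tensor_sum eval_tensor_scaleR eval_tensor_symm_vec_mat_power
          eval_tensor_vec_tensor_power atLeast0AtMost mult.assoc)
  qed (simp_all add: vec_tensor_power_in_tensors symmetric_tensor_vec_power
      integrable_tcoeff_gaussian_power[OF gauss])
  then show ?thesis
    by (simp add: E_def linear_sum[OF L] linear_scale[OF L])
qed

text \<open>
  The tensor Hermite polynomial of \<open>\<theta> + \<epsilon>\<close> is an unbiased estimator of the tensor power of \<open>\<theta>\<close>. Its
  evaluation at \<open>v\<close> is the scalar Hermite polynomial in \<open>v \<bullet> lift1 (\<theta> + \<epsilon>)\<close>; each power in it has
  an expectation given by the projection formula with \<open>h = g - k\<close>.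
\<close>

lemma has_bochner_integral_hermite_tensor:
  fixes \<epsilon> :: "'w \<Rightarrow> real ^ 'd::finite"
    and L :: "'d option tensor \<Rightarrow> 'c::{banach, second_countable_topology}"
  assumes gauss: "\<epsilon> \<in> borel_measurable M" "is_normal 0 \<Sigma> (distr M borel \<epsilon>)" "nonneg_definite \<Sigma>"
    and L: "linear L"
  shows "has_bochner_integral M
    (\<lambda>\<omega>. \<Sum>k=0..g. (herm_coeff (2 * g) k * (-1) ^ k) *\<^sub>R
      L (symm (vec_tensor (lift1 (\<theta> + \<epsilon> \<omega>)) ^ (2 * g - 2 * k) * mat_tensor (lift0 \<Sigma>) ^ k)))
    (L (vec_tensor (lift1 \<theta>) ^ (2 * g)))"
proof -
  let ?P = "\<lambda>\<omega> k. vec_tensor (lift1 (\<theta> + \<epsilon> \<omega>)) ^ (2 * g - 2 * k)"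
  let ?S = "mat_tensor (lift0 \<Sigma>)"
  define F where "F \<omega> = (\<Sum>k=0..g. (herm_coeff (2 * g) k * (-1) ^ k) *\<^sub>R symm (?P \<omega> k * ?S ^ k))" for \<omega>
  have "has_bochner_integral M (\<lambda>\<omega>. L (F \<omega>)) (L (vec_tensor (lift1 \<theta>) ^ (2 * g)))"
  proof (rule has_bochner_integral_symmetric_tensor[OF L])
    show "F \<omega> \<in> tensors (2 * g)" for \<omega>
      unfolding F_def by (intro tensors_sum tensors_scaleR tensors_symm vec_mat_power_in_tensors) simp
    show "symmetric_tensor (F \<omega>)" for \<omega>
      unfolding F_def by (intro symmetric_tensor_sum symmetric_tensor_scaleR symmetric_tensor_symm)
    show "integrable M (\<lambda>\<omega>. tcoeff (F \<omega>) js)" for js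
    proof -
      have "integrable M (\<lambda>\<omega>. tcoeff (symm (?P \<omega> k * ?S ^ k)) js)" for k
      proof -
        have "linear (\<lambda>T. tcoeff (symm (T * ?S ^ k)) js)"
          by (rule linearI) (simp_all add: distrib_right linear_add[OF linear_symm]
              linear_scale[OF linear_symm] linear_add[OF linear_tcoeff] linear_scale[OF linear_tcoeff])
        moreover have "integrable M (\<lambda>\<omega>. tcoeff (?P \<omega> k) js)" for js
          using integrable_tcoeff_gaussian_power[OF gauss, of \<theta> "g - k" js] by (simp add: diff_mult_distrib2)
        ultimately show ?thesis
          by (rule has_bochner_integral_linear_tensor[THEN integrable.intros, OF _ vec_tensor_power_in_tensors])
      qed
      then show ?thesis
        by (simp add: F_def tcoeff_sum scaleR_tensor.rep_eq)
    qed
    show "has_bochner_integral M (\<lambda>\<omega>. eval_tensor (2 * g) (F \<omega>) v)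
        (eval_tensor (2 * g) (vec_tensor (lift1 \<theta>) ^ (2 * g)) v)" for v
    proof -
      let ?s = "v \<bullet> lift1 \<theta>" and ?\<sigma> = "v \<bullet> (lift0 \<Sigma> *v v)"
      have "has_bochner_integral M
        (\<lambda>\<omega>. \<Sum>k\<le>g. herm_coeff (2 * g) k * (-1) ^ k * ?\<sigma> ^ k * (v \<bullet> lift1 (\<theta> + \<epsilon> \<omega>)) ^ (2 * (g - k)))
        (\<Sum>k\<le>g. herm_coeff (2 * g) k * (-1) ^ k * ?\<sigma> ^ k *
          (\<Sum>l\<le>g - k. herm_coeff (2 * (g - k)) l * ?s ^ (2 * (g - k) - 2 * l) * ?\<sigma> ^ l))"
        by (intro has_bochner_integral_sum has_bochner_integral_mult_right
            has_bochner_integral_gaussian_projection_power[OF gauss])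
      moreover have "eval_tensor (2 * g) (F \<omega>) v =
          (\<Sum>k\<le>g. herm_coeff (2 * g) k * (-1) ^ k * ?\<sigma> ^ k * (v \<bullet> lift1 (\<theta> + \<epsilon> \<omega>)) ^ (2 * (g - k)))" for \<omega>
        unfolding F_def eval_tensor_sum eval_tensor_scaleR atLeast0AtMost
        by (intro sum.cong refl) (simp add: eval_tensor_symm_vec_mat_power diff_mult_distrib2)
      ultimately show ?thesis
        by (simp add: herm_coeff_inversion eval_tensor_vec_tensor_power)
    qed
  qed (simp_all add: vec_tensor_power_in_tensors symmetric_tensor_vec_power)
  then show ?thesis
    by (simp add: F_def linear_sum[OF L] linear_scale[OF L])
qed

section \<open>Unbiasedness\<close>

lemma moment_matrix_empirical_measure:
  fixes idx :: "'b::finite \<Rightarrow> 'd::finite option \<Rightarrow> nat"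
  shows "moment_matrix idx (empirical_measure n x) =
    (1 / real n) *\<^sub>R (\<Sum>i=1..n. outer (veronese idx (x i)) (veronese idx (x i)))"
proof -
  have "continuous_on UNIV (\<lambda>y. outer (veronese idx y) (veronese idx y))"
    unfolding outer_def matrix_matrix_mult_def columnvector_def rowvector_def veronese_def monom_at_def
    by (intro continuous_on_vec_lambda continuous_on_sum continuous_on_mult continuous_on_prod
        continuous_on_power continuous_on_component continuous_on_id)
  then have "(\<lambda>y. outer (veronese idx y) (veronese idx y)) \<in> borel_measurable borel"
    by (rule borel_measurable_continuous_onI)
  moreover have "x \<in> measurable (uniform_count_measure {1..n}) borel"
    by (auto simp: measurable_def space_uniform_count_measure sets_uniform_count_measure)
  ultimately have "moment_matrix idx (empirical_measure n x) =
      (\<integral>i. outer (veronese idx (x i)) (veronese idx (x i)) \<partial>uniform_count_measure {1..n})"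
    by (simp add: moment_matrix_def empirical_measure_def integral_distr)
  then show ?thesis
    by (simp add: uniform_count_measure_def lebesgue_integral_point_measure_finite scaleR_sum_right)
qed

theorem theorem3p7:
  fixes M :: "'w measure"
    and \<epsilon> X :: "nat \<Rightarrow> 'w \<Rightarrow> real ^ 'd"
    and \<theta> :: "nat \<Rightarrow> real ^ 'd"
    and \<Sigma> :: "real ^ 'd ^ 'd"
    and idx :: "'b::finite \<Rightarrow> 'd option \<Rightarrow> nat"
    and g n :: nat
  assumes "prob_space M"
    and "n \<ge> 1" and "g \<ge> 1"
    and "bij_betw idx UNIV (multi_indices g)"
    and "nonneg_definite \<Sigma>"
    and "prob_space.indep_vars M (\<lambda>_. borel) \<epsilon> {1..n}"
    and "\<And>i. i \<in> {1..n} \<Longrightarrow> is_normal 0 \<Sigma> (distr M borel (\<epsilon> i))"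
    and "\<And>i \<omega>. i \<in> {1..n} \<Longrightarrow> \<omega> \<in> space M \<Longrightarrow> X i \<omega> = \<theta> i + \<epsilon> i \<omega>"
  shows "integrable M (\<lambda>\<omega>. moment_matrix idx (empirical_measure n (\<lambda>i. X i \<omega>))) \<and>
    (\<integral>\<omega>. moment_matrix idx (empirical_measure n (\<lambda>i. X i \<omega>)) \<partial>M) =
      (1 / real n) *\<^sub>R (\<Sum>i=1..n. \<Sum>k=0..g. herm_coeff (2 * g) k *\<^sub>R
         hmat (gamma_gamma idx g
           (symm (vec_tensor (lift1 (\<theta> i)) ^ (2 * g - 2 * k) * mat_tensor (lift0 \<Sigma>) ^ k)))) \<and>
    integrable M (\<lambda>\<omega>. debiased_estimator idx g \<Sigma> n (\<lambda>i. X i \<omega>)) \<and>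
    (\<integral>\<omega>. debiased_estimator idx g \<Sigma> n (\<lambda>i. X i \<omega>) \<partial>M) =
      moment_matrix idx (empirical_measure n \<theta>)"
proof -
  interpret prob_space M by fact
  note lin = linear_hmat_gamma_gamma[OF assms(4)]
  have gauss: "\<epsilon> i \<in> borel_measurable M" "is_normal 0 \<Sigma> (distr M borel (\<epsilon> i))" "nonneg_definite \<Sigma>"
    if "i \<in> {1..n}" for i
    using assms(5,6,7) that by (auto simp: indep_vars_def)
  \<comment> \<open>The model equation for \<open>X\<close> is known on \<open>space M\<close> only, so it enters via congruence of integrals.\<close>
  have X: "(\<Sum>i=1..n. f (X i \<omega>)) = (\<Sum>i=1..n. f (\<theta> i + \<epsilon> i \<omega>))"
    if "\<omega> \<in> space M" for f :: "real ^ 'd \<Rightarrow> real ^ 'b ^ 'b" and \<omega>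
    using assms(8) that by (intro sum.cong refl) auto
  have "has_bochner_integral M
      (\<lambda>\<omega>. (1 / real n) *\<^sub>R (\<Sum>i=1..n. hmat (gamma_gamma idx g (vec_tensor (lift1 (\<theta> i + \<epsilon> i \<omega>)) ^ (2 * g)))))
      ((1 / real n) *\<^sub>R (\<Sum>i=1..n. \<Sum>k=0..g. herm_coeff (2 * g) k *\<^sub>R
         hmat (gamma_gamma idx g
           (symm (vec_tensor (lift1 (\<theta> i)) ^ (2 * g - 2 * k) * mat_tensor (lift0 \<Sigma>) ^ k)))))"
    by (intro has_bochner_integral_scaleR_right has_bochner_integral_sum
        has_bochner_integral_gaussian_tensor_power[OF gauss lin])
  then have 1: "has_bochner_integral M (\<lambda>\<omega>. moment_matrix idx (empirical_measure n (\<lambda>i. X i \<omega>)))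
      ((1 / real n) *\<^sub>R (\<Sum>i=1..n. \<Sum>k=0..g. herm_coeff (2 * g) k *\<^sub>R
         hmat (gamma_gamma idx g
           (symm (vec_tensor (lift1 (\<theta> i)) ^ (2 * g - 2 * k) * mat_tensor (lift0 \<Sigma>) ^ k)))))"
    by (subst has_bochner_integral_cong[OF refl _ refl])
      (simp_all add: moment_matrix_empirical_measure gamma_gamma_lift1[OF assms(4)]
        X[of _ "\<lambda>x. outer (veronese idx x) (veronese idx x)"] del: One_nat_def)
  have "has_bochner_integral M
      (\<lambda>\<omega>. (1 / real n) *\<^sub>R (\<Sum>i=1..n. debiased_term idx g \<Sigma> (\<theta> i + \<epsilon> i \<omega>)))
      ((1 / real n) *\<^sub>R (\<Sum>i=1..n. hmat (gamma_gamma idx g (vec_tensor (lift1 (\<theta> i)) ^ (2 * g)))))"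
    unfolding debiased_term_def
    by (intro has_bochner_integral_scaleR_right has_bochner_integral_sum
        has_bochner_integral_hermite_tensor[OF gauss lin])
  then have 2: "has_bochner_integral M (\<lambda>\<omega>. debiased_estimator idx g \<Sigma> n (\<lambda>i. X i \<omega>))
      (moment_matrix idx (empirical_measure n \<theta>))"
    by (subst has_bochner_integral_cong[OF refl _ refl])
      (simp_all add: debiased_estimator_def moment_matrix_empirical_measure
        gamma_gamma_lift1[OF assms(4)] X del: One_nat_def)
  from 1 2 show ?thesis
    by (simp add: has_bochner_integral_iff)
qed

end
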